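(* Let $K\subset\mathbb{C}$ be a convex domain with positive depth $h_K>0$ and diameter $d$, and let $1\le q<\infty$. Then for every $n\in\mathbb{N}$ and every $p\in\mathcal{P}_n(K)$, $$\|p'\|_{L^q(\partial K)}\ge \frac{h_K^4}{3000\, d^5}\, n\, \|p\|_{L^q(\partial K)}.$$
   Context: A convex domain is a compact convex subset $K\subset\mathbb{C}$ with nonempty interior; $d=\max_{z,z'\in K}|z-z'|$. A unit vector $\nu\in\mathbb{C}$ is an outer normal to $K$ at $\zeta\in\partial K$ if $\mathrm{Re}((z-\zeta)\overline{\nu})\le 0$ for all $z\in K$; then $(\zeta+\nu\mathbb{R})\cap K=[\zeta,\zeta-h\nu]$ for some $h\ge 0$. The local depth $h_K(\zeta)$ is the maximum of these lengths $h$ over all outer unit normals $\nu$ at $\zeta$, and the depth of $K$ is $h_K:=\inf_{\zeta\in\partial K}h_K(\zeta)$. $\|f\|_{L^q(\partial K)}=\left(\int_{\partial K}|f(z)|^q|dz|\right)^{1/q}$ with arc length measure. $\mathcal{P}_n(K)$ is the set of complex polynomials of degree exactly $n$ with all zeros in $K$. *)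

theory Defs
  imports "HOL-Analysis.Analysis" "HOL-Computational_Algebra.Polynomial"
begin

text \<open>One-dimensional Hausdorff (outer) measure on the complex plane, normalised
  so that it agrees with arc length on rectifiable curves (sum of diameters).\<close>
definition hausdorff1 :: "complex set \<Rightarrow> ennreal" where
  "hausdorff1 A =
     (SUP \<delta>\<in>{0<..}. INF C\<in>{C :: nat \<Rightarrow> complex set.
          A \<subseteq> (\<Union>i. C i) \<and> (\<forall>i. bounded (C i) \<and> diameter (C i) \<le> \<delta>)}.
        (\<Sum>i. ennreal (diameter (C i))))"

definition arc_measure :: "complex set \<Rightarrow> complex measure" where
  "arc_measure S = measure_of UNIV (sets borel) (\<lambda>A. hausdorff1 (A \<inter> S))"

definition Lq_boundary_norm :: "complex set \<Rightarrow> real \<Rightarrow> (complex \<Rightarrow> complex) \<Rightarrow> real" where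
  "Lq_boundary_norm K q f =
     (integral\<^sup>L (arc_measure (frontier K)) (\<lambda>z. norm (f z) powr q)) powr (1 / q)"

definition convex_domain :: "complex set \<Rightarrow> bool" where
  "convex_domain K \<longleftrightarrow> compact K \<and> convex K \<and> interior K \<noteq> {}"

definition outer_normal :: "complex set \<Rightarrow> complex \<Rightarrow> complex \<Rightarrow> bool" where
  "outer_normal K \<zeta> \<nu> \<longleftrightarrow> norm \<nu> = 1 \<and> (\<forall>z\<in>K. Re ((z - \<zeta>) * cnj \<nu>) \<le> 0)"

definition local_depth :: "complex set \<Rightarrow> complex \<Rightarrow> real" where
  "local_depth K \<zeta> = Sup {h. h \<ge> 0 \<and> (\<exists>\<nu>. outer_normal K \<zeta> \<nu> \<and>
        {\<zeta> + complex_of_real t * \<nu> | t. True} \<inter> K = closed_segment \<zeta> (\<zeta> - complex_of_real h * \<nu>))}"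

definition depth :: "complex set \<Rightarrow> real" where
  "depth K = (INF \<zeta>\<in>frontier K. local_depth K \<zeta>)"

end

theory Submission
  imports Defs "HOL-Complex_Analysis.Conformal_Mappings" "HOL-Real_Asymp.Real_Asymp"
    "HOL-Computational_Algebra.Fundamental_Theorem_Algebra"
begin

text \<open>
  Let \<open>\<zeta>\<close> be a boundary point with outer normal \<open>\<nu>\<close> and a chord of length \<open>h\<close>, comparable to the depth,
  along \<open>-\<nu>\<close>. With \<open>w\<^sub>i = h\<nu> / (\<zeta> - z\<^sub>i)\<close> for the zeros \<open>z\<^sub>i\<close> of \<open>p\<close> one has \<open>Re w\<^sub>i \<ge> 0\<close>,
  \<open>\<Sum> w\<^sub>i = h\<nu> p'(\<zeta>) / p(\<zeta>)\<close> and \<open>p(\<zeta> - th\<nu>) / p(\<zeta>) = \<Prod> (1 - t w\<^sub>i)\<close>. Averaging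
  \<open>ln \<bar>1 - t w\<^sub>i\<bar>\<close> over \<open>1/2 \<le> t \<le> 1\<close> shows that either \<open>\<bar>p'(\<zeta>)\<bar> \<ge> a n \<bar>p(\<zeta>)\<bar>\<close> with
  \<open>a = h\<^sup>2 / (450 d\<^sup>3)\<close>, or \<open>\<bar>p\<bar>\<close> grows by the factor \<open>exp (9 a d n)\<close> somewhere on the chord and hence,
  by the maximum principle, somewhere on the boundary. In the second case, integrating along the
  boundary, whose length is at most \<open>9 d\<close>, gives
  \<open>9 a d n \<bar>p(\<zeta>)\<bar> \<le> \<integral> \<bar>p'\<bar> \<le> 9 d m\<close>, where \<open>m\<close> is the mean of \<open>\<bar>p'\<bar>\<close>. So
  \<open>(a n \<bar>p\<bar>)\<^sup>q \<le> \<bar>p'\<bar>\<^sup>q + m\<^sup>q\<close> on the boundary, and integration together with Jensen's inequality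
  finishes the proof.\<close>

section \<open>Growth along the inner normal\<close>

lemma continuous_mult_ln_abs: "continuous_on A (\<lambda>x::real. x * ln \<bar>x\<bar>)"
proof (rule continuous_at_imp_continuous_on, intro ballI)
  fix x :: real
  have "((\<lambda>x::real. x * ln \<bar>x\<bar>) \<longlongrightarrow> 0) (at 0)"
    by (rule filterlim_split_at) real_asymp+
  then show "isCont (\<lambda>x::real. x * ln \<bar>x\<bar>) x"
    by (cases "x = 0") (auto simp: isCont_def intro!: tendsto_intros)
qed

text \<open>The primitive extends continuously across the singularity \<tau>, so the fundamental
  theorem applies with one exceptional point. If \<tau> is an endpoint, its term vanishes because
  \<open>0 * ln 0 = 0\<close>.\<close>

lemma has_integral_ln_abs_diff:
  fixes a b \<tau> :: real
  assumes "a \<le> \<tau>" "\<tau> \<le> b"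
  shows "((\<lambda>t. ln \<bar>t - \<tau>\<bar>) has_integral
           ((b - \<tau>) * ln (b - \<tau>) + (\<tau> - a) * ln (\<tau> - a) - (b - a))) {a..b}"
proof -
  define F where "F t = (t - \<tau>) * ln \<bar>t - \<tau>\<bar> - (t - \<tau>)" for t
  have "((\<lambda>t. ln \<bar>t - \<tau>\<bar>) has_integral (F b - F a)) {a..b}"
  proof (rule fundamental_theorem_of_calculus_interior_strong[of "{\<tau>}"])
    show "continuous_on {a..b} F"
      unfolding F_def
      by (intro continuous_intros continuous_on_compose2[OF continuous_mult_ln_abs[of UNIV], of _ "\<lambda>t. t - \<tau>"]) auto
    show "(F has_vector_derivative ln \<bar>t - \<tau>\<bar>) (at t)" if "t \<in> {a<..<b} - {\<tau>}" for t
    proof (cases "t > \<tau>")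
      case True
      then have "((\<lambda>t. (t - \<tau>) * ln (t - \<tau>) - (t - \<tau>)) has_real_derivative ln (t - \<tau>)) (at t)"
        by (auto intro!: derivative_eq_intros)
      then have "(F has_real_derivative ln (t - \<tau>)) (at t)"
        by (rule has_field_derivative_transform_within_open[of _ _ _ "{\<tau><..}"])
           (use True in \<open>auto simp: F_def\<close>)
      then show ?thesis
        using True by (simp add: has_real_derivative_iff_has_vector_derivative)
    next
      case False
      with that have *: "t < \<tau>" by auto
      then have "((\<lambda>t. (t - \<tau>) * ln (\<tau> - t) - (t - \<tau>)) has_real_derivative ln (\<tau> - t)) (at t)"
        by (auto intro!: derivative_eq_intros simp: divide_simps) (simp_all add: algebra_simps)?
      then have "(F has_real_derivative ln (\<tau> - t)) (at t)"
        by (rule has_field_derivative_transform_within_open[of _ _ _ "{..<\<tau>}"])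
           (use * in \<open>auto simp: F_def\<close>)
      then show ?thesis
        using * by (simp add: has_real_derivative_iff_has_vector_derivative)
    qed
  qed (use assms in auto)
  also have "F b - F a = (b - \<tau>) * ln (b - \<tau>) + (\<tau> - a) * ln (\<tau> - a) - (b - a)"
    using assms by (simp add: F_def algebra_simps)
  finally show ?thesis .
qed

text \<open>The lower bound is the tangent line of the convex function \<open>x * ln x\<close> at
  \<open>c\<close>.\<close>

lemma mult_ln_lower:
  fixes x c :: real
  assumes "0 \<le> x" "0 < c"
  shows "x * ln x \<ge> x - c + x * ln c"
proof (cases "x = 0")
  case False
  with assms have "ln (c / x) \<le> c / x - 1"
    by (intro ln_le_minus_one) auto
  with False assms have "ln c - ln x \<le> c / x - 1"
    by (simp add: ln_div)
  then have "x * (ln c - ln x) \<le> x * (c / x - 1)"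
    using assms by (intro mult_left_mono) auto
  with False show ?thesis by (simp add: algebra_simps)
qed (use assms in auto)

text \<open>For \<open>Re w > 1/4\<close> the factor may vanish on the interval; there the
  integrability of the logarithm replaces a pointwise bound.\<close>

lemma ln_norm_one_minus_minorant:
  fixes w :: complex and \<eta> :: real
  assumes u: "0 \<le> Re w" and \<eta>: "0 < \<eta>" "\<eta> \<le> 1" "\<eta> \<le> norm w"
  shows "\<exists>g I Z. finite Z \<and> (g has_integral I) {1/2..1} \<and> I \<ge> (\<eta>\<^sup>2 / 16 - 17 * Re w) / 2 \<and>
           (\<forall>t\<in>{1/2..1} - Z. 1 - of_real t * w \<noteq> 0 \<and> g t \<le> ln (norm (1 - of_real t * w)))"
proof (cases "Re w \<le> 1/4")
  case True
  \<comment> \<open>A constant minorant, half of a bound for the logarithm of the squared norm: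
    there the factor \<open>1 + \<eta>\<^sup>2 / 4\<close> contributes
    \<open>\<eta>\<^sup>2 / 8\<close> and the factor \<open>1 - 2 * Re w\<close> contributes
    \<open>- 4 * Re w\<close>.\<close>
  define g where "g = (\<eta>\<^sup>2 / 16 - 2 * Re w)"
  have *: "1 - of_real t * w \<noteq> 0 \<and> g \<le> ln (norm (1 - of_real t * w))" if t: "t \<in> {1/2..1}" for t
  proof -
    have "(norm (1 - of_real t * w))\<^sup>2 = 1 - 2 * t * Re w + t\<^sup>2 * (norm w)\<^sup>2"
      unfolding cmod_power2 by (simp add: power2_eq_square algebra_simps)
    moreover have "2 * t * Re w \<le> 2 * Re w"
      using t u by (intro mult_right_mono) auto
    moreover have "(1/2)\<^sup>2 * \<eta>\<^sup>2 \<le> t\<^sup>2 * (norm w)\<^sup>2"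
      using t \<eta> by (intro mult_mono power_mono) auto
    moreover have "(1/2)\<^sup>2 * \<eta>\<^sup>2 = \<eta>\<^sup>2 / 4"
      by (simp add: power2_eq_square)
    \<comment> \<open>A product is wanted so that the logarithm splits; it differs from the sum by a
      nonpositive cross term.\<close>
    moreover have "(1 + \<eta>\<^sup>2 / 4) * (1 - 2 * Re w) \<le> 1 - 2 * Re w + \<eta>\<^sup>2 / 4"
      using u by (simp add: algebra_simps)
    ultimately have 1: "(1 + \<eta>\<^sup>2 / 4) * (1 - 2 * Re w) \<le> (norm (1 - of_real t * w))\<^sup>2"
      by linarith
    have s: "0 < \<eta>\<^sup>2 / 4" "\<eta>\<^sup>2 / 4 \<le> 1/4"
      using \<eta> by (auto simp: power_le_one)
    have pos: "0 < (1 + \<eta>\<^sup>2 / 4) * (1 - 2 * Re w)"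
      using s True by (intro mult_pos_pos) linarith+
    then have nz: "1 - of_real t * w \<noteq> 0"
      using 1 by auto
    have "\<eta>\<^sup>2/4 * (\<eta>\<^sup>2/4) \<le> \<eta>\<^sup>2/4 * (1/4)"
      using s by (intro mult_left_mono) auto
    with ln_one_plus_pos_lower_bound[of "\<eta>\<^sup>2/4"] s
    have "ln (1 + \<eta>\<^sup>2/4) \<ge> \<eta>\<^sup>2/8"
      unfolding power2_eq_square[of "\<eta>\<^sup>2/4"] by linarith
    moreover have "(2 * Re w) * (2 * Re w) \<le> (2 * Re w) * (1/2)"
      using u True by (intro mult_left_mono) auto
    with ln_one_minus_pos_lower_bound[of "2 * Re w"] u True
    have "ln (1 - 2 * Re w) \<ge> - 4 * Re w"
      unfolding power2_eq_square[of "2 * Re w"] by linarith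
    moreover have "ln ((1 + \<eta>\<^sup>2 / 4) * (1 - 2 * Re w)) = ln (1 + \<eta>\<^sup>2/4) + ln (1 - 2 * Re w)"
      using s True by (intro ln_mult_pos) linarith+
    moreover have "ln ((1 + \<eta>\<^sup>2 / 4) * (1 - 2 * Re w)) \<le> ln ((norm (1 - of_real t * w))\<^sup>2)"
      using 1 pos nz by (intro ln_mono) auto
    moreover have "ln ((norm (1 - of_real t * w))\<^sup>2) = 2 * ln (norm (1 - of_real t * w))"
      using nz by (simp add: ln_realpow)
    ultimately show ?thesis
      using nz by (simp add: g_def)
  qed
  have "((\<lambda>_. g) has_integral g / 2) {1/2..1::real}"
    using has_integral_const_real[of g "1/2" 1] by simp
  then show ?thesis
    using * u by (intro exI[of _ "\<lambda>_. g"] exI[of _ "g/2"] exI[of _ "{}"]) (auto simp: g_def)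
next
  case False
  define u where "u = Re w"
  \<comment> \<open>\<open>1 / u\<close> is the zero of the real part \<open>1 - t * u\<close>. Its
    nearest point \<tau> in [1/2, 1] is at least as close to every \<open>t\<close> of the
    interval.\<close>
  define \<tau> where "\<tau> = max (1/2) (min 1 (1/u))"
  have u4: "u > 1/4" using False by (simp add: u_def)
  have \<tau>: "1/2 \<le> \<tau>" "\<tau> \<le> 1" by (auto simp: \<tau>_def)
  define J where "J = (1 - \<tau>) * ln (1 - \<tau>) + (\<tau> - 1/2) * ln (\<tau> - 1/2) - (1 - 1/2)"
  have int: "((\<lambda>t. ln u + ln \<bar>t - \<tau>\<bar>) has_integral (ln u / 2 + J)) {1/2..1}"
    using has_integral_add[OF has_integral_const_real[of "ln u" "1/2" 1] has_integral_ln_abs_diff[OF \<tau>]]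
    by (simp add: J_def)
  \<comment> \<open>With both tangents taken at 1/2, the coefficients of \<open>ln (1/2)\<close> add
    up to 1/2 whatever \<tau> is.\<close>
  have "(1 - \<tau>) * ln (1 - \<tau>) \<ge> (1 - \<tau>) - 1/2 + (1 - \<tau>) * ln (1/2)"
       "(\<tau> - 1/2) * ln (\<tau> - 1/2) \<ge> (\<tau> - 1/2) - 1/2 + (\<tau> - 1/2) * ln (1/2)"
    using \<tau> by (intro mult_ln_lower; linarith)+
  moreover have "(1 - \<tau>) * ln (1/2) + (\<tau> - 1/2) * ln (1/2) = - ln 2 / 2"
    by (simp add: ln_div algebra_simps)
  ultimately have J: "J \<ge> - 1 - ln 2 / 2"
    by (simp add: J_def)
  have "ln u \<ge> ln (1/4)"
    using u4 by (intro ln_mono) auto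
  moreover have "ln (1/4 :: real) = - 2 * ln 2"
    using ln_realpow[of "2::real" 2] by (simp add: ln_div)
  ultimately have "ln u \<ge> - 2 * ln 2" by simp
  \<comment> \<open>This accounts for the constant 17: the left side is at least -1 - (3/2) ln 2,
    and for \<open>Re w > 1/4\<close> the loss \<open>17 * Re w\<close> exceeds 17/4, which is
    enough.\<close>
  with J ln2_le_25_over_36 have "ln u / 2 + J \<ge> (1 / 16 - 17/4) / 2"
    by (simp add: field_simps)
  moreover have "\<eta>\<^sup>2 \<le> 1" using \<eta> by (simp add: power_le_one)
  ultimately have I: "ln u / 2 + J \<ge> (\<eta>\<^sup>2 / 16 - 17 * Re w) / 2"
    using u4 by (simp add: u_def)
  \<comment> \<open>At \<tau> the minorant has the default value \<open>ln u\<close>, since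
    \<open>ln 0 = 0\<close>, and may be too large there; hence the exceptional set.\<close>
  have *: "1 - of_real t * w \<noteq> 0 \<and> ln u + ln \<bar>t - \<tau>\<bar> \<le> ln (norm (1 - of_real t * w))"
    if t: "t \<in> {1/2..1} - {\<tau>, 1/u}" for t
  proof -
    have "\<bar>t - \<tau>\<bar> \<le> \<bar>t - 1/u\<bar>"
      using t by (auto simp: \<tau>_def max_def min_def)
    then have "u * \<bar>t - \<tau>\<bar> \<le> u * \<bar>t - 1/u\<bar>"
      using u4 by (intro mult_left_mono) auto
    also have "\<dots> = \<bar>u * (t - 1/u)\<bar>"
      using u4 by (simp add: abs_mult)
    also have "\<dots> = \<bar>Re (1 - of_real t * w)\<bar>"
      using u4 by (simp add: u_def algebra_simps)
    also have "\<dots> \<le> norm (1 - of_real t * w)"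
      by (rule abs_Re_le_cmod)
    finally have le: "u * \<bar>t - \<tau>\<bar> \<le> norm (1 - of_real t * w)" .
    have pos: "0 < u * \<bar>t - \<tau>\<bar>"
      using t u4 by auto
    have "ln u + ln \<bar>t - \<tau>\<bar> = ln (u * \<bar>t - \<tau>\<bar>)"
      using t u4 by (intro ln_mult_pos[symmetric]) auto
    also have "\<dots> \<le> ln (norm (1 - of_real t * w))"
      using le pos by (intro ln_mono) auto
    finally show ?thesis using le pos by auto
  qed
  show ?thesis
    using int I * by (intro exI[of _ "\<lambda>t. ln u + ln \<bar>t - \<tau>\<bar>"] exI[of _ "ln u / 2 + J"] exI[of _ "{\<tau>, 1/u}"]) auto
qed

text \<open>The minorants of the factors are summed and averaged: their integral exceeds
  \<open>E / 2\<close> over an interval of length 1/2, so the sum reaches \<open>E\<close> at some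
  point outside the exceptional sets.\<close>

lemma prod_norm_one_minus_lower:
  fixes w :: "nat \<Rightarrow> complex" and \<eta> E :: real
  assumes "\<And>i. i < n \<Longrightarrow> 0 \<le> Re (w i)" and \<eta>: "0 < \<eta>" "\<eta> \<le> 1"
    and "\<And>i. i < n \<Longrightarrow> \<eta> \<le> norm (w i)"
    and E: "E < real n * \<eta>\<^sup>2 / 16 - 17 * (\<Sum>i<n. Re (w i))"
  shows "\<exists>t\<in>{1/2..1}. exp E \<le> (\<Prod>i<n. norm (1 - of_real t * w i))"
proof -
  have "\<forall>i\<in>{..<n}. \<exists>g I Z. finite Z \<and> (g has_integral I) {1/2..1} \<and>
           I \<ge> (\<eta>\<^sup>2 / 16 - 17 * Re (w i)) / 2 \<and>
           (\<forall>t\<in>{1/2..1} - Z. 1 - of_real t * w i \<noteq> 0 \<and> g t \<le> ln (norm (1 - of_real t * w i)))"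
    using assms by (intro ballI ln_norm_one_minus_minorant) auto
  then obtain g I Z where *: "\<forall>i\<in>{..<n}. finite (Z i) \<and> (g i has_integral I i) {1/2..1} \<and>
           I i \<ge> (\<eta>\<^sup>2 / 16 - 17 * Re (w i)) / 2 \<and>
           (\<forall>t\<in>{1/2..1} - Z i. 1 - of_real t * w i \<noteq> 0 \<and> g i t \<le> ln (norm (1 - of_real t * w i)))"
    unfolding bchoice_iff by blast
  then have
    Z: "\<And>i. i < n \<Longrightarrow> finite (Z i)" and
    gI: "\<And>i. i < n \<Longrightarrow> (g i has_integral I i) {1/2..1}" and
    I: "\<And>i. i < n \<Longrightarrow> I i \<ge> (\<eta>\<^sup>2 / 16 - 17 * Re (w i)) / 2" and
    g: "\<And>i t. i < n \<Longrightarrow> t \<in> {1/2..1} - Z i \<Longrightarrow>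
           1 - of_real t * w i \<noteq> 0 \<and> g i t \<le> ln (norm (1 - of_real t * w i))"
    by blast+
  define ZZ where "ZZ = (\<Union>i<n. Z i)"
  have fin: "finite ZZ" using Z by (auto simp: ZZ_def)
  have int: "((\<lambda>t. \<Sum>i<n. g i t) has_integral (\<Sum>i<n. I i)) {1/2..1}"
    using gI by (intro has_integral_sum) auto
  have "E / 2 < (\<Sum>i<n. (\<eta>\<^sup>2 / 16 - 17 * Re (w i)) / 2)"
    using E by (simp add: sum_subtractf sum_distrib_left flip: sum_divide_distrib)
  also have "\<dots> \<le> (\<Sum>i<n. I i)"
    using I by (intro sum_mono) auto
  finally have EI: "E / 2 < (\<Sum>i<n. I i)" .
  have "\<exists>t\<in>{1/2..1} - ZZ. E \<le> (\<Sum>i<n. g i t)"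
  proof (rule ccontr)
    assume "\<not> ?thesis"
    then have neg: "\<And>t. t \<in> {1/2..1} - ZZ \<Longrightarrow> (\<Sum>i<n. g i t) < E"
      by force
    \<comment> \<open>Redefining the sum on the finite exceptional set makes the bound by
      \<open>E\<close> hold at every point without changing the integral.\<close>
    define G where "G t = (if t \<in> ZZ then E else (\<Sum>i<n. g i t))" for t
    have intG: "(G has_integral (\<Sum>i<n. I i)) {1/2..1}"
      by (rule has_integral_spike_finite[OF fin _ int]) (auto simp: G_def)
    have intE: "((\<lambda>_. E) has_integral E / 2) {1/2..1::real}"
      using has_integral_const_real[of E "1/2" 1] by simp
    have "(\<Sum>i<n. I i) \<le> E / 2"
      by (rule has_integral_le[OF intG intE]) (use neg in \<open>force simp: G_def\<close>)
    with EI show False by simp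
  qed
  then obtain t where t: "t \<in> {1/2..1} - ZZ" "E \<le> (\<Sum>i<n. g i t)" by blast
  have nz: "norm (1 - of_real t * w i) > 0" if "i < n" for i
    using g[OF that, of t] t that by (auto simp: ZZ_def)
  have "E \<le> (\<Sum>i<n. ln (norm (1 - of_real t * w i)))"
    using t g by (intro order.trans[OF t(2)] sum_mono) (auto simp: ZZ_def)
  also have "\<dots> = ln (\<Prod>i<n. norm (1 - of_real t * w i))"
    using nz by (subst ln_prod) auto
  finally have "exp E \<le> exp (ln (\<Prod>i<n. norm (1 - of_real t * w i)))"
    by simp
  also have "\<dots> = (\<Prod>i<n. norm (1 - of_real t * w i))"
    using nz by (intro exp_ln prod_pos) auto
  finally show ?thesis
    using t by blast
qed

section \<open>Logarithmic derivative and the growth dichotomy\<close>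

lemma poly_pderiv_prod_linear:
  fixes r :: "nat \<Rightarrow> 'a::field"
  assumes "\<And>i. i < n \<Longrightarrow> x \<noteq> r i"
  shows "poly (pderiv (\<Prod>i<n. [:- r i, 1:])) x = poly (\<Prod>i<n. [:- r i, 1:]) x * (\<Sum>i<n. 1 / (x - r i))"
  using assms
proof (induction n)
  case 0
  show ?case by (simp add: pderiv_1)
next
  case (Suc n)
  define P where "P = (\<Prod>i<n. [:- r i, 1:])"
  have IH: "poly (pderiv P) x = poly P x * (\<Sum>i<n. 1 / (x - r i))"
    unfolding P_def using Suc by simp
  have "poly (pderiv (P * [:- r n, 1:])) x = poly P x + (x - r n) * poly (pderiv P) x"
    by (simp only: pderiv_mult) (simp add: pderiv_pCons algebra_simps)
  also have "\<dots> = (poly P x * (x - r n)) * ((\<Sum>i<n. 1 / (x - r i)) + 1 / (x - r n))"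
  proof -
    have "(poly P x * (x - r n)) * (1 / (x - r n)) = poly P x"
      using Suc.prems[of n] by simp
    then show ?thesis
      by (simp only: distrib_left IH) (simp only: ac_simps)
  qed
  finally have "poly (pderiv (P * [:- r n, 1:])) x =
      (poly P x * poly [:- r n, 1:] x) * ((\<Sum>i<n. 1 / (x - r i)) + 1 / (x - r n))"
    by simp
  then show ?case
    by (simp only: prod.lessThan_Suc sum.lessThan_Suc poly_mult P_def[symmetric])
qed

text \<open>For the scaled reciprocals \<open>w i\<close>, the half plane containing the zeros gives
  \<open>Re (w i) \<ge> 0\<close> and the disc containing them gives
  \<open>norm (w i) \<ge> h / d\<close>. A small derivative makes the sum of the real parts small,
  which forces the product of the \<open>1 - t * w i\<close> to be large for some
  \<open>t\<close>.\<close>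

lemma pderiv_or_growth_along_normal:
  fixes p :: "complex poly" and \<zeta> \<nu> :: complex and h d :: real
  assumes zeros: "\<And>z. poly p z = 0 \<Longrightarrow> Re ((z - \<zeta>) * cnj \<nu>) \<le> 0 \<and> norm (z - \<zeta>) \<le> d"
    and \<nu>: "norm \<nu> = 1" and h: "0 < h" "h \<le> d"
  shows "h\<^sup>2 / (450 * d ^ 3) * real (degree p) * norm (poly p \<zeta>) \<le> norm (poly (pderiv p) \<zeta>) \<or>
         (\<exists>t\<in>{1/2..1}. exp (9 * (h / d)\<^sup>2 * real (degree p) / 450) * norm (poly p \<zeta>)
              \<le> norm (poly p (\<zeta> - of_real (t * h) * \<nu>)))"
proof (cases "poly p \<zeta> = 0 \<or> degree p = 0")
  case True
  then show ?thesis by auto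
next
  case False
  define n where "n = degree p"
  have n: "n > 0" and p0: "poly p \<zeta> \<noteq> 0" using False by (auto simp: n_def)
  have d: "0 < d" using h by simp
  define \<eta> where "\<eta> = h / d"
  have \<eta>: "0 < \<eta>" "\<eta> \<le> 1" using h d by (auto simp: \<eta>_def)
  obtain r where r: "smult (lead_coeff p) (\<Prod>i<n. [:- r i, 1:]) = p"
    unfolding n_def by (rule complex_poly_decompose')
  define l where "l = lead_coeff p"
  have l: "l \<noteq> 0" using p0 by (auto simp: l_def)
  have p_eq: "poly p x = l * (\<Prod>i<n. x - r i)" for x
    using arg_cong[OF r, of "\<lambda>q. poly q x"] by (simp add: poly_prod l_def)
  have root: "poly p (r i) = 0" if "i < n" for i
    using that by (auto simp: p_eq)
  have ne: "\<zeta> \<noteq> r i" if "i < n" for i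
    using root[OF that] p0 by auto
  have p'_eq: "poly (pderiv p) \<zeta> = poly p \<zeta> * (\<Sum>i<n. 1 / (\<zeta> - r i))"
    using arg_cong[OF r, of "\<lambda>q. poly (pderiv q) \<zeta>"] arg_cong[OF r, of "\<lambda>q. poly q \<zeta>"]
      poly_pderiv_prod_linear[of n \<zeta> r] ne
    by (simp add: pderiv_smult) (metis mult.assoc)
  define w where "w i = of_real h * \<nu> / (\<zeta> - r i)" for i
  have Re_w: "0 \<le> Re (w i)" if "i < n" for i
  proof -
    have "Re (w i) = h * Re (\<nu> * cnj (\<zeta> - r i)) / (norm (\<zeta> - r i))\<^sup>2"
      unfolding w_def by (subst complex_div_cnj) (simp add: algebra_simps)
    moreover have "Re (\<nu> * cnj (\<zeta> - r i)) = - Re ((r i - \<zeta>) * cnj \<nu>)"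
      by (simp add: algebra_simps)
    then have "0 \<le> h * Re (\<nu> * cnj (\<zeta> - r i))"
      using zeros[OF root[OF that]] h by (intro mult_nonneg_nonneg) linarith+
    ultimately show ?thesis
      by (metis divide_nonneg_nonneg zero_le_power2)
  qed
  have norm_w: "\<eta> \<le> norm (w i)" if "i < n" for i
  proof -
    have "norm (\<zeta> - r i) \<le> d"
      using zeros[OF root[OF that]] by (simp add: norm_minus_commute)
    moreover have "0 < norm (\<zeta> - r i)"
      using ne[OF that] by simp
    ultimately show ?thesis
      using h \<nu> by (auto simp: w_def \<eta>_def norm_divide norm_mult intro!: divide_left_mono)
  qed
  show ?thesis
  proof (cases "norm (poly (pderiv p) \<zeta>) < h\<^sup>2 / (450 * d ^ 3) * real n * norm (poly p \<zeta>)")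
    case True
    have "(\<Sum>i<n. w i) = of_real h * \<nu> * (\<Sum>i<n. 1 / (\<zeta> - r i))"
      by (simp add: w_def sum_distrib_left)
    also have "\<dots> = of_real h * \<nu> * (poly (pderiv p) \<zeta> / poly p \<zeta>)"
      using p0 by (simp add: p'_eq)
    finally have "norm (\<Sum>i<n. w i) = h * (norm (poly (pderiv p) \<zeta>) / norm (poly p \<zeta>))"
      using h \<nu> by (simp add: norm_mult norm_divide)
    also have "\<dots> \<le> h * (h\<^sup>2 / (450 * d ^ 3) * real n)"
      using True p0 h by (intro mult_left_mono) (auto simp: field_simps)
    also have "\<dots> = \<eta>\<^sup>2 * \<eta> * real n / 450"
      by (simp add: \<eta>_def field_simps power2_eq_square power3_eq_cube)
    \<comment> \<open>One factor \<eta> is given up so that the loss has the same order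
      \<open>\<eta>\<^sup>2\<close> as the gain.\<close>
    also have "\<dots> \<le> \<eta>\<^sup>2 * 1 * real n / 450"
      using \<eta> by (intro divide_right_mono mult_right_mono mult_left_mono) auto
    finally have "(\<Sum>i<n. Re (w i)) \<le> \<eta>\<^sup>2 * real n / 450"
      using complex_Re_le_cmod[of "\<Sum>i<n. w i"] by simp
    moreover have "0 < \<eta>\<^sup>2 * real n"
      using \<eta> n by simp
    \<comment> \<open>In units of \<open>\<eta>\<^sup>2 * n\<close> the gain 1/16 exceeds 28/450 and
      the loss is at most 17/450, so more than 9/450 remains. The 9 will match the length bound
      \<open>9 * d\<close>.\<close>
    ultimately have "9 * \<eta>\<^sup>2 * real n / 450 < real n * \<eta>\<^sup>2 / 16 - 17 * (\<Sum>i<n. Re (w i))"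
      by (simp add: field_simps)
    then obtain t where t: "t \<in> {1/2..1}"
        "exp (9 * \<eta>\<^sup>2 * real n / 450) \<le> (\<Prod>i<n. norm (1 - of_real t * w i))"
      using prod_norm_one_minus_lower[of n w \<eta>, OF Re_w \<eta> norm_w] by blast
    \<comment> \<open>Moving from \<zeta> by \<open>t * h\<close> against \<nu> multiplies each
      linear factor \<open>\<zeta> - r i\<close> by \<open>1 - t * w i\<close>.\<close>
    have "poly p (\<zeta> - of_real (t * h) * \<nu>) = l * (\<Prod>i<n. (\<zeta> - r i) * (1 - of_real t * w i))"
      using ne by (auto simp: p_eq w_def field_simps intro!: prod.cong)
    also have "\<dots> = poly p \<zeta> * (\<Prod>i<n. 1 - of_real t * w i)"
      by (simp add: p_eq prod.distrib)
    finally have "norm (poly p (\<zeta> - of_real (t * h) * \<nu>)) =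
        norm (poly p \<zeta>) * (\<Prod>i<n. norm (1 - of_real t * w i))"
      by (simp add: norm_mult prod_norm)
    also have "\<dots> \<ge> norm (poly p \<zeta>) * exp (9 * \<eta>\<^sup>2 * real n / 450)"
      using t by (intro mult_left_mono) auto
    finally show ?thesis
      using t(1) unfolding \<eta>_def n_def by (auto simp: mult.commute)
  qed (auto simp: n_def)
qed

section \<open>Normals and chords of convex domains\<close>

lemma outer_normal_ex:
  assumes "convex K" "closed K" "interior K \<noteq> {}" "\<zeta> \<in> frontier K"
  shows "\<exists>\<nu>. outer_normal K \<zeta> \<nu>"
proof -
  have "\<zeta> \<in> K" "\<zeta> \<notin> rel_interior K"
    using assms by (auto simp: frontier_def rel_interior_nonempty_interior)
  then obtain a where a: "a \<noteq> 0" "\<And>z. z \<in> K \<Longrightarrow> a \<bullet> \<zeta> \<le> a \<bullet> z"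
    using supporting_hyperplane_rel_boundary[OF assms(1)] by blast
  \<comment> \<open>The supporting functional is minimal at \<zeta>, so the outward direction
    carries a minus sign.\<close>
  define \<nu> where "\<nu> = - a / norm a"
  have "Re ((z - \<zeta>) * cnj \<nu>) = (a \<bullet> \<zeta> - a \<bullet> z) / norm a" for z
    by (simp add: \<nu>_def inner_complex_def add_divide_distrib diff_divide_distrib algebra_simps)
  moreover have "norm \<nu> = 1"
    using a(1) by (simp add: \<nu>_def norm_divide)
  ultimately have "outer_normal K \<zeta> \<nu>"
    unfolding outer_normal_def using a by (simp add: divide_nonpos_pos)
  then show ?thesis by blast
qed

text \<open>The parameters at which the line lies in \<open>K\<close> form a compact convex set of
  reals containing 0, and normality excludes positive ones. With the existence of a normal, this
  makes the set under the supremum in \<open>local_depth\<close> nonempty.\<close>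

lemma outer_normal_chord:
  assumes "compact K" "convex K" "\<zeta> \<in> K" "outer_normal K \<zeta> \<nu>"
  shows "\<exists>h\<ge>0. {\<zeta> + complex_of_real t * \<nu> | t. True} \<inter> K = closed_segment \<zeta> (\<zeta> - complex_of_real h * \<nu>)"
proof -
  define T where "T = (\<lambda>t. \<zeta> + of_real t * \<nu>) -` K"
  have \<nu>: "norm \<nu> = 1" and le: "\<And>z. z \<in> K \<Longrightarrow> Re ((z - \<zeta>) * cnj \<nu>) \<le> 0"
    using assms(4) by (auto simp: outer_normal_def)
  have nonpos: "t \<le> 0" if "t \<in> T" for t
  proof -
    have "Re (of_real t * \<nu> * cnj \<nu>) \<le> 0"
      using le[of "\<zeta> + of_real t * \<nu>"] that by (simp add: T_def)
    then show ?thesis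
      using \<nu> by (simp add: mult.assoc complex_norm_square[symmetric])
  qed
  have "closed T"
    unfolding T_def using assms(1)
    by (intro closed_vimage compact_imp_closed continuous_intros)
  moreover have "bounded T"
  proof -
    obtain B where B: "\<And>z. z \<in> K \<Longrightarrow> norm z \<le> B"
      using compact_imp_bounded[OF assms(1)] unfolding bounded_iff by blast
    have "\<bar>t\<bar> \<le> B + norm \<zeta>" if "t \<in> T" for t
    proof -
      have "\<bar>t\<bar> = norm ((\<zeta> + of_real t * \<nu>) - \<zeta>)"
        using \<nu> by (simp add: norm_mult)
      also have "\<dots> \<le> norm (\<zeta> + of_real t * \<nu>) + norm \<zeta>"
        by (rule norm_triangle_ineq4)
      finally show ?thesis using B[of "\<zeta> + of_real t * \<nu>"] that by (simp add: T_def)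
    qed
    then show ?thesis unfolding bounded_iff by (intro exI[of _ "B + norm \<zeta>"]) auto
  qed
  moreover have "convex T"
  proof (rule convexI)
    fix x y u v :: real
    assume xy: "x \<in> T" "y \<in> T" "0 \<le> u" "0 \<le> v" and uv: "u + v = 1"
    have "u *\<^sub>R (\<zeta> + of_real x * \<nu>) + v *\<^sub>R (\<zeta> + of_real y * \<nu>) \<in> K"
      using xy uv by (intro convexD[OF assms(2)]) (auto simp: T_def)
    also have "u *\<^sub>R (\<zeta> + of_real x * \<nu>) + v *\<^sub>R (\<zeta> + of_real y * \<nu>)
        = of_real (u + v) * \<zeta> + of_real (u * x + v * y) * \<nu>"
      by (simp add: scaleR_conv_of_real algebra_simps)
    finally show "u *\<^sub>R x + v *\<^sub>R y \<in> T"
      by (simp add: T_def uv)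
  qed
  ultimately obtain a b where ab: "T = {a..b}"
    using connected_compact_interval_1[of T] by (auto simp: compact_eq_bounded_closed convex_connected)
  have "0 \<in> T" using assms(3) by (simp add: T_def)
  with ab nonpos have b: "b = 0" and a: "a \<le> 0" by (auto intro: antisym)
  have "{\<zeta> + complex_of_real t * \<nu> | t. True} \<inter> K = (\<lambda>t. \<zeta> + of_real t * \<nu>) ` {a..0}"
    using ab b unfolding T_def by blast
  also have "{a..0} = closed_segment 0 a"
    using a by (simp add: closed_segment_eq_real_ivl)
  also have "(\<lambda>t. \<zeta> + of_real t * \<nu>) ` closed_segment 0 a = closed_segment \<zeta> (\<zeta> + of_real a * \<nu>)"
  proof -
    have "\<zeta> + of_real ((1 - u) *\<^sub>R 0 + u *\<^sub>R a) * \<nu> = (1 - u) *\<^sub>R \<zeta> + u *\<^sub>R (\<zeta> + of_real a * \<nu>)" for u :: real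
      by (simp add: scaleR_conv_of_real algebra_simps)
    then show ?thesis
      by (simp only: closed_segment_image_interval image_image)
  qed
  finally show ?thesis
    using a by (intro exI[of _ "-a"]) auto
qed

text \<open>The supremum in \<open>local_depth\<close> is not shown to be attained, so the chord is
  only claimed to be longer than a given \<open>c\<close> below the depth.\<close>

lemma depth_chord_ex:
  assumes K: "convex_domain K" and \<zeta>: "\<zeta> \<in> frontier K" and c: "c < depth K"
  shows "\<exists>\<nu> h. outer_normal K \<zeta> \<nu> \<and> c < h \<and> h \<le> diameter K \<and> closed_segment \<zeta> (\<zeta> - complex_of_real h * \<nu>) \<subseteq> K"
proof -
  define chord where "chord \<xi> \<nu> h \<longleftrightarrow>
      {\<xi> + complex_of_real t * \<nu> | t. True} \<inter> K = closed_segment \<xi> (\<xi> - complex_of_real h * \<nu>)" for \<xi> \<nu> h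
  define H where "H \<xi> = {h. h \<ge> 0 \<and> (\<exists>\<nu>. outer_normal K \<xi> \<nu> \<and> chord \<xi> \<nu> h)}" for \<xi>
  have chord_sub: "closed_segment \<xi> (\<xi> - complex_of_real h * \<nu>) \<subseteq> K" if "chord \<xi> \<nu> h" for \<xi> \<nu> h
    using that unfolding chord_def by (metis Int_lower2)
  have int: "interior K \<noteq> {}"
    using K by (simp add: convex_domain_def)
  have cK: "compact K" "convex K" "closed K" "bounded K"
    using K by (auto simp: convex_domain_def compact_imp_closed compact_imp_bounded)
  have le_diam: "h \<le> diameter K" if hH: "h \<in> H \<xi>" for h \<xi>
  proof -
    obtain \<nu> where \<nu>: "norm \<nu> = 1" and "h \<ge> 0" "chord \<xi> \<nu> h"
      using hH unfolding H_def outer_normal_def by blast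
    then have "dist \<xi> (\<xi> - complex_of_real h * \<nu>) \<le> diameter K"
      using cK chord_sub[of \<xi> \<nu> h] by (intro diameter_bounded_bound) auto
    then show ?thesis using \<nu> \<open>h \<ge> 0\<close> by (simp add: dist_norm norm_mult)
  qed
  \<comment> \<open>Boundedness and nonemptiness make the real \<open>Sup\<close> and
    \<open>INF\<close> genuine bounds rather than unspecified values.\<close>
  then have bdd: "bdd_above (H \<xi>)" for \<xi>
    unfolding bdd_above_def by blast
  have ne: "H \<xi> \<noteq> {}" if \<xi>: "\<xi> \<in> frontier K" for \<xi>
  proof -
    have "\<xi> \<in> K" using that cK by (simp add: frontier_def)
    moreover obtain \<nu> where "outer_normal K \<xi> \<nu>"
      using outer_normal_ex[OF cK(2,3) int \<xi>] by blast
    ultimately show ?thesis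
      using outer_normal_chord[OF cK(1,2), of \<xi> \<nu>, folded chord_def] unfolding H_def by blast
  qed
  have ld: "local_depth K \<xi> = Sup (H \<xi>)" for \<xi>
    by (simp add: local_depth_def H_def chord_def)
  have "0 \<le> local_depth K \<xi>" if \<xi>: "\<xi> \<in> frontier K" for \<xi>
  proof -
    obtain h where "h \<in> H \<xi>" using ne[OF \<xi>] by blast
    then show ?thesis
      unfolding ld using bdd[of \<xi>] by (intro cSup_upper2[of h]) (auto simp: H_def)
  qed
  then have "bdd_below (local_depth K ` frontier K)"
    by (intro bdd_belowI[of _ 0]) auto
  then have "depth K \<le> local_depth K \<zeta>"
    unfolding depth_def using \<zeta> by (intro cINF_lower)
  with c have "c < Sup (H \<zeta>)" by (simp add: ld)
  then obtain h where "h \<in> H \<zeta>" "c < h"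
    using less_cSup_iff[OF ne[OF \<zeta>] bdd] by blast
  then show ?thesis
    using le_diam[of h \<zeta>] chord_sub unfolding H_def by blast
qed

section \<open>Arc length as Hausdorff measure\<close>

text \<open>Cutting the interval into \<open>N\<close> equal pieces covers the image by sets of
  diameter at most \<open>c * T / N\<close>, with total at most \<open>c * T\<close> for every mesh
  \<delta>.\<close>

lemma hausdorff1_lipschitz_path_le:
  fixes g :: "real \<Rightarrow> complex" and c T :: real
  assumes c: "0 \<le> c" and T: "0 < T"
    and g: "\<And>s t. s \<in> {0..T} \<Longrightarrow> t \<in> {0..T} \<Longrightarrow> norm (g s - g t) \<le> c * \<bar>s - t\<bar>"
  shows "hausdorff1 (g ` {0..T}) \<le> ennreal (c * T)"
  unfolding hausdorff1_def
proof (rule SUP_least)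
  fix \<delta> :: real assume "\<delta> \<in> {0<..}"
  then have \<delta>: "0 < \<delta>" by simp
  obtain N :: nat where N: "c * T / \<delta> < real N"
    using reals_Archimedean2 by blast
  moreover have "0 \<le> c * T / \<delta>" using c T \<delta> by simp
  ultimately have N0: "0 < N" by (cases N) auto
  \<comment> \<open>Empty sets, of diameter 0, pad the finite cover to a sequence.\<close>
  define C where "C i = (if i < N then g ` {real i * (T / N)..real (Suc i) * (T / N)} else {})" for i
  have sub: "t \<in> {0..T}" if "i < N" "t \<in> {real i * (T / N)..real (Suc i) * (T / N)}" for i t
  proof -
    have "real (Suc i) * (T / N) \<le> real N * (T / N)"
      using that T by (intro mult_right_mono) auto
    moreover have "0 \<le> real i * (T / N)"
      using T by simp
    ultimately show ?thesis
      using that N0 by auto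
  qed
  have dC: "norm (x - y) \<le> c * T / N" if "x \<in> C i" "y \<in> C i" for i x y
  proof -
    from that obtain s t where st: "i < N" "x = g s" "y = g t"
        "s \<in> {real i * (T / N)..real (Suc i) * (T / N)}" "t \<in> {real i * (T / N)..real (Suc i) * (T / N)}"
      by (auto simp: C_def split: if_splits)
    have "\<bar>s - t\<bar> \<le> real (Suc i) * (T / N) - real i * (T / N)"
      using st(4,5) by (intro abs_leI) auto
    also have "\<dots> = T / N" by (simp add: algebra_simps add_divide_distrib)
    finally have "c * \<bar>s - t\<bar> \<le> c * (T / N)"
      using c by (intro mult_left_mono)
    then show ?thesis
      using g[OF sub[OF st(1,4)] sub[OF st(1,5)]] st by simp
  qed
  have diam: "diameter (C i) \<le> c * T / N" for i
    using c T by (intro diameter_le dC) auto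
  have "c * T / N \<le> \<delta>"
    using N N0 \<delta> by (simp add: field_simps)
  then have diam': "diameter (C i) \<le> \<delta>" for i
    using diam[of i] by simp
  have bnd: "bounded (C i)" for i
    unfolding bounded_two_points dist_norm using dC by blast
  have cover: "g ` {0..T} \<subseteq> (\<Union>i. C i)"
  proof
    fix x assume "x \<in> g ` {0..T}"
    then obtain t where t: "0 \<le> t" "t \<le> T" "x = g t" by auto
    show "x \<in> (\<Union>i. C i)"
    \<comment> \<open>At \<open>t = T\<close> the floor used below would give the index
      \<open>N\<close>, one past the last piece.\<close>
    proof (cases "t = T")
      case True
      have "real (Suc (N - 1)) * (T / N) = T"
        using N0 by simp
      moreover have "real (N - 1) * (T / N) \<le> real N * (T / N)"
        using T by (intro mult_right_mono) auto
      ultimately have "x \<in> C (N - 1)"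
        using True t N0 by (auto simp: C_def simp del: of_nat_Suc)
      then show ?thesis by blast
    next
      case False
      define i where "i = nat \<lfloor>t / (T / N)\<rfloor>"
      have TN: "0 < T / N" using T N0 by simp
      have i: "real i = of_int \<lfloor>t / (T / N)\<rfloor>"
        using t T by (simp add: i_def)
      have 1: "real i \<le> t / (T / N)" and 2: "t / (T / N) < real i + 1"
        unfolding i by linarith+
      have "real i \<le> t / (T / N)" by (fact 1)
      also have "\<dots> < T / (T / N)"
        using t False TN by (intro divide_strict_right_mono) auto
      also have "\<dots> = N" using T by simp
      finally have "i < N" by simp
      have lo: "real i * (T / N) \<le> t"
        using 1 TN by (simp only: pos_le_divide_eq)
      have Suc_i: "real (Suc i) = real i + 1"
        by simp
      have "t < real (Suc i) * (T / N)"
        unfolding Suc_i using 2 TN by (simp only: pos_divide_less_eq)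
      then have "t \<le> real (Suc i) * (T / N)"
        by (rule less_imp_le)
      with lo have "t \<in> {real i * (T / N)..real (Suc i) * (T / N)}"
        by (rule atLeastAtMost_iff[THEN iffD2, OF conjI])
      then have "x \<in> g ` {real i * (T / N)..real (Suc i) * (T / N)}"
        unfolding t(3) by (rule imageI)
      with \<open>i < N\<close> have "x \<in> C i"
        by (simp only: C_def if_True)
      then show ?thesis by blast
    qed
  qed
  have "(\<Sum>i. ennreal (diameter (C i))) = (\<Sum>i<N. ennreal (diameter (C i)))"
    by (rule suminf_finite) (auto simp: C_def)
  also have "\<dots> \<le> (\<Sum>i<N. ennreal (c * T / N))"
    using diam by (intro sum_mono ennreal_leI)
  also have "\<dots> = ennreal (c * T)"
    using N0 c T by (simp add: ennreal_of_nat_eq_real_of_nat flip: ennreal_mult)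
  finally show "(INF C\<in>{C. g ` {0..T} \<subseteq> (\<Union>i. C i) \<and> (\<forall>i. bounded (C i) \<and> diameter (C i) \<le> \<delta>)}.
      \<Sum>i. ennreal (diameter (C i))) \<le> ennreal (c * T)"
    using cover bnd diam' by (intro INF_lower2[of C]) auto
qed

text \<open>Each covering set meets \<open>A\<close> in a part that \<open>u\<close> maps into an
  interval of length \<open>c\<close> times the diameter. A Lipschitz bound at distances up to
  \<delta> suffices, since covers of mesh \<delta> already bound \<open>hausdorff1\<close> from
  below. The measure is an outer one because the image of \<open>A\<close> may fail to be
  measurable.\<close>

lemma outer_measure_image_le_hausdorff1:
  fixes u :: "complex \<Rightarrow> real"
  assumes c: "0 < c" and \<delta>: "0 < \<delta>"
    and u: "\<And>z w. z \<in> A \<Longrightarrow> w \<in> A \<Longrightarrow> norm (z - w) \<le> \<delta> \<Longrightarrow> \<bar>u z - u w\<bar> \<le> c * norm (z - w)"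
  shows "outer_measure_of lborel (u ` A) \<le> ennreal c * hausdorff1 A"
proof -
  have main: "outer_measure_of lborel (u ` A) \<le> ennreal c * (\<Sum>i. ennreal (diameter (C i)))"
    if cov: "A \<subseteq> (\<Union>i. C i)" and C: "\<And>i. bounded (C i)" "\<And>i. diameter (C i) \<le> \<delta>" for C :: "nat \<Rightarrow> complex set"
  proof -
    define s where "s i = Inf (u ` (A \<inter> C i))" for i
    define J where "J i = {s i..s i + c * diameter (C i)}" for i
    have diff: "u z - c * diameter (C i) \<le> u w" if "z \<in> A \<inter> C i" "w \<in> A \<inter> C i" for z w i
    proof -
      have le: "norm (z - w) \<le> diameter (C i)"
        using diameter_bounded_bound[OF C(1)] that by (auto simp: dist_norm)
      then have "\<bar>u z - u w\<bar> \<le> c * norm (z - w)"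
        using that C(2)[of i] by (intro u) auto
      also have "\<dots> \<le> c * diameter (C i)"
        using le c by (intro mult_left_mono) auto
      finally show ?thesis by simp
    qed
    have "u ` A \<subseteq> (\<Union>i. J i)"
    proof
      fix x assume "x \<in> u ` A"
      then obtain z i where z: "x = u z" "z \<in> A \<inter> C i" using cov by blast
      have "s i \<le> u z"
        unfolding s_def using z diff[OF z(2)]
        by (intro cInf_lower bdd_belowI2[of _ "u z - c * diameter (C i)"]) auto
      moreover have "u z - c * diameter (C i) \<le> s i"
        unfolding s_def using z diff[OF z(2)] by (intro cInf_greatest) auto
      ultimately show "x \<in> (\<Union>i. J i)"
        using z by (auto simp: J_def)
    qed
    then have "outer_measure_of lborel (u ` A) \<le> outer_measure_of lborel (\<Union>i. J i)"
      by (rule outer_measure_of_mono)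
    also have "\<dots> = emeasure lborel (\<Union>i. J i)"
      by (intro outer_measure_of_eq) (auto simp: J_def)
    also have "\<dots> \<le> (\<Sum>i. emeasure lborel (J i))"
      by (intro emeasure_subadditive_countably) (auto simp: J_def)
    also have "\<dots> = (\<Sum>i. ennreal c * ennreal (diameter (C i)))"
      using c diameter_ge_0[OF C(1)] by (simp add: J_def ennreal_mult)
    finally show ?thesis by simp
  qed
  \<comment> \<open>Dividing by \<open>c\<close> turns the estimate into a lower bound common to all
    covers, which passes to the infimum.\<close>
  have "outer_measure_of lborel (u ` A) / ennreal c \<le>
      (INF C\<in>{C :: nat \<Rightarrow> complex set. A \<subseteq> (\<Union>i. C i) \<and> (\<forall>i. bounded (C i) \<and> diameter (C i) \<le> \<delta>)}.
        \<Sum>i. ennreal (diameter (C i)))"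
    using c main by (intro INF_greatest divide_le_posI_ennreal) auto
  also have "\<dots> \<le> hausdorff1 A"
    unfolding hausdorff1_def using \<delta> by (intro SUP_upper) auto
  finally have "ennreal c * (outer_measure_of lborel (u ` A) / ennreal c) \<le> ennreal c * hausdorff1 A"
    by (intro mult_left_mono) auto
  moreover have "ennreal c * (x / ennreal c) = x" for x
    using c by (subst ennreal_times_divide, subst mult.commute, subst ennreal_mult_divide_eq) auto
  ultimately show ?thesis by simp
qed

text \<open>The first alternative is the junk value of \<^const>\<open>measure_of\<close> for a set function that
  is not countably additive. Both boundary norms vanish there, so the additivity of the Hausdorff
  measure on Borel sets is never needed.\<close>

lemma arc_measure_cases:
  "(\<forall>A. emeasure (arc_measure S) A = 0) \<or>
         (\<forall>A\<in>sets borel. emeasure (arc_measure S) A = hausdorff1 (A \<inter> S))"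
  by (auto simp: arc_measure_def emeasure_measure_of_conv sets.sigma_sets_eq[of borel, simplified])

lemma sets_arc_measure [simp, measurable_cong]: "sets (arc_measure S) = sets borel"
  by (simp add: arc_measure_def sets.sigma_sets_eq[of borel, simplified])

lemma space_arc_measure [simp]: "space (arc_measure S) = UNIV"
  by (simp add: arc_measure_def space_measure_of_conv)

text \<open>Slicing \<open>S\<close> by the size of \<open>p'\<close> makes \<open>\<bar>p\<bar>\<close> locally Lipschitz with a nearly optimal
  constant on each slice, so no parametrisation of \<open>S\<close> is required.\<close>

lemma norm_poly_diff_le_nn_integral:
  fixes p :: "complex poly" and M :: "complex measure"
  assumes K: "compact K" "convex K" and S: "compact S" "connected S" "S \<subseteq> K"
    and ab: "a \<in> S" "b \<in> S"
    and M: "sets M = sets borel" "\<And>A. A \<in> sets borel \<Longrightarrow> emeasure M A = hausdorff1 (A \<inter> S)"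
    and fin: "emeasure M UNIV < \<infinity>"
  shows "ennreal (norm (poly p b) - norm (poly p a)) \<le> (\<integral>\<^sup>+z. ennreal (norm (poly (pderiv p) z)) \<partial>M)"
proof -
  define u where "u z = norm (poly p z)" for z
  define f where "f z = norm (poly (pderiv p) z)" for z
  have f_meas [measurable]: "f \<in> borel_measurable borel"
    unfolding f_def by (intro borel_measurable_continuous_onI continuous_intros)
  have f_M [measurable]: "f \<in> borel_measurable M"
    using f_meas measurable_cong_sets[OF M(1) refl] by blast
  have S_borel [measurable]: "S \<in> sets borel"
    using S(1) by (simp add: borel_closed compact_imp_closed)
  have approx: "ennreal (u b - u a) \<le> (\<integral>\<^sup>+z. ennreal (f z) \<partial>M) + ennreal (2 * \<epsilon>) * emeasure M UNIV"
    if \<epsilon>: "0 < \<epsilon>" for \<epsilon>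
  proof -
    have "uniformly_continuous_on K (poly (pderiv p))"
      using K(1) by (intro compact_uniformly_continuous continuous_intros) auto
    then obtain \<delta> where \<delta>: "0 < \<delta>"
        "\<And>x y. x \<in> K \<Longrightarrow> y \<in> K \<Longrightarrow> dist y x < \<delta> \<Longrightarrow> dist (poly (pderiv p) y) (poly (pderiv p) x) < \<epsilon>"
      unfolding uniformly_continuous_on_def using \<epsilon> by metis
    define A where "A j = S \<inter> f -` {real j * \<epsilon>..<real (Suc j) * \<epsilon>}" for j
    have A_borel: "A j \<in> sets borel" for j
      unfolding A_def using measurable_sets[OF f_meas, of "{real j * \<epsilon>..<real (Suc j) * \<epsilon>}"] by auto
    \<comment> \<open>In \<open>j + 2\<close>, one \<epsilon> beyond \<open>j\<close> pays for the
      width of the slice and one for the variation of the derivative along a short segment. The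
      segment lies in \<open>K\<close> but may leave \<open>S\<close>, so uniform continuity was
      taken on \<open>K\<close>.\<close>
    have out: "outer_measure_of lborel (u ` A j) \<le> ennreal (real (j + 2) * \<epsilon>) * hausdorff1 (A j)" for j
    proof (rule outer_measure_image_le_hausdorff1[where \<delta> = "\<delta> / 2"])
      fix z w assume zw: "z \<in> A j" "w \<in> A j" "norm (z - w) \<le> \<delta> / 2"
      then have zwK: "z \<in> K" "w \<in> K" using S by (auto simp: A_def)
      have seg: "closed_segment z w \<subseteq> K"
        using zwK K by (simp add: closed_segment_subset)
      have "norm (poly (pderiv p) x) \<le> real (j + 2) * \<epsilon>" if x: "x \<in> closed_segment z w" for x
      proof -
        have "dist x z \<le> dist w z"
          using x by (metis dist_commute dist_in_closed_segment)
        then have "dist x z < \<delta>"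
          using zw \<delta>(1) by (simp add: dist_norm norm_minus_commute)
        then have "norm (poly (pderiv p) x - poly (pderiv p) z) < \<epsilon>"
          using \<delta>(2)[of z x] seg x zwK by (auto simp: dist_norm)
        moreover have "norm (poly (pderiv p) z) < real (Suc j) * \<epsilon>"
          using zw by (auto simp: A_def f_def)
        moreover have "norm (poly (pderiv p) x) \<le> norm (poly (pderiv p) x - poly (pderiv p) z) + norm (poly (pderiv p) z)"
          by (metis diff_add_cancel norm_triangle_ineq)
        ultimately show ?thesis by (simp add: algebra_simps)
      qed
      then have "norm (poly p z - poly p w) \<le> real (j + 2) * \<epsilon> * norm (z - w)"
        by (intro field_differentiable_bound[of "closed_segment z w" _ "poly (pderiv p)"])
           (auto intro: poly_DERIV has_field_derivative_at_within)
      then show "\<bar>u z - u w\<bar> \<le> real (j + 2) * \<epsilon> * norm (z - w)"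
        unfolding u_def using norm_triangle_ineq3[of "poly p z" "poly p w"] by linarith
    qed (use \<delta> \<epsilon> in auto)
    \<comment> \<open>The images may fail to be measurable; each is replaced by a measurable hull of
      the same outer measure.\<close>
    have "\<forall>j. \<exists>E\<in>sets lborel. u ` A j \<subseteq> E \<and> outer_measure_of lborel (u ` A j) = emeasure lborel E"
      by (intro allI outer_measure_of_attain) auto
    then obtain E where E: "\<And>j. E j \<in> sets lborel" "\<And>j. u ` A j \<subseteq> E j"
        "\<And>j. outer_measure_of lborel (u ` A j) = emeasure lborel (E j)"
      by metis
    have level: "z \<in> A (nat \<lfloor>f z / \<epsilon>\<rfloor>)" and level_unique: "z \<in> A j \<Longrightarrow> j = nat \<lfloor>f z / \<epsilon>\<rfloor>" if "z \<in> S" for z j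
    proof -
      have iff: "z \<in> A j \<longleftrightarrow> j = nat \<lfloor>f z / \<epsilon>\<rfloor>" for j
      proof -
        have "0 \<le> f z / \<epsilon>" using \<epsilon> by (simp add: f_def)
        then have "j = nat \<lfloor>f z / \<epsilon>\<rfloor> \<longleftrightarrow> real j \<le> f z / \<epsilon> \<and> f z / \<epsilon> < real j + 1"
          by linarith
        also have "\<dots> \<longleftrightarrow> z \<in> A j"
          using that \<epsilon> by (auto simp: A_def field_simps)
        finally show ?thesis by blast
      qed
      show "z \<in> A (nat \<lfloor>f z / \<epsilon>\<rfloor>)" "z \<in> A j \<Longrightarrow> j = nat \<lfloor>f z / \<epsilon>\<rfloor>"
        using iff by blast+
    qed
    \<comment> \<open>By the intermediate value property, the images of the slices cover the whole
      interval between the two values.\<close>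
    have "connected (u ` S)"
      unfolding u_def using S(2) by (intro connected_continuous_image continuous_intros)
    then have "{u a..u b} \<subseteq> u ` S"
      using ab by (intro connected_contains_Icc) auto
    also have "\<dots> \<subseteq> (\<Union>j. E j)"
      using level E(2) by blast
    finally have sub: "{u a..u b} \<subseteq> (\<Union>j. E j)" .
    \<comment> \<open>If \<open>u b < u a\<close>, both sides are 0.\<close>
    have "ennreal (u b - u a) = emeasure lborel {u a..u b}"
      by (cases "u a \<le> u b") (auto simp: ennreal_neg)
    also have "\<dots> \<le> emeasure lborel (\<Union>j. E j)"
      using sub E(1) by (intro emeasure_mono) auto
    also have "\<dots> \<le> (\<Sum>j. emeasure lborel (E j))"
      using E(1) by (intro emeasure_subadditive_countably) auto
    also have "\<dots> \<le> (\<Sum>j. ennreal (real (j + 2) * \<epsilon>) * hausdorff1 (A j))"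
      using out by (intro suminf_le) (auto simp: E(3))
    also have "\<dots> = (\<Sum>j. ennreal (real (j + 2) * \<epsilon>) * emeasure M (A j))"
      using M(2)[OF A_borel] by (simp add: A_def Int_ac)
    also have "\<dots> = (\<Sum>j. \<integral>\<^sup>+z. ennreal (real (j + 2) * \<epsilon>) * indicator (A j) z \<partial>M)"
      using A_borel M(1) by (simp add: nn_integral_cmult_indicator)
    also have "\<dots> = (\<integral>\<^sup>+z. (\<Sum>j. ennreal (real (j + 2) * \<epsilon>) * indicator (A j) z) \<partial>M)"
      using A_borel M(1) by (intro nn_integral_suminf[symmetric]) auto
    also have "\<dots> \<le> (\<integral>\<^sup>+z. ennreal (f z) + ennreal (2 * \<epsilon>) \<partial>M)"
    proof (rule nn_integral_mono)
      fix z
      show "(\<Sum>j. ennreal (real (j + 2) * \<epsilon>) * indicator (A j) z) \<le> ennreal (f z) + ennreal (2 * \<epsilon>)"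
      proof (cases "z \<in> S")
        case True
        \<comment> \<open>The slices are disjoint, so the series reduces to the one slice containing
          \<open>z\<close>.\<close>
        define i where "i = nat \<lfloor>f z / \<epsilon>\<rfloor>"
        have "z \<notin> A j" if "j \<noteq> i" for j
          using level_unique[OF True, of j] that unfolding i_def by blast
        then have zero: "indicator (A j) z = (0::ennreal)" if "j \<noteq> i" for j
          using that by simp
        have "(\<Sum>j. ennreal (real (j + 2) * \<epsilon>) * indicator (A j) z) =
            (\<Sum>j\<in>{i}. ennreal (real (j + 2) * \<epsilon>) * indicator (A j) z)"
          by (rule suminf_finite) (simp_all add: zero)
        also have "\<dots> = ennreal (real (i + 2) * \<epsilon>) * indicator (A i) z"
          by (simp only: sum.insert finite.emptyI empty_iff not_False_eq_True sum.empty add_0_right)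
        also have "\<dots> \<le> ennreal (real (i + 2) * \<epsilon>)"
          by (simp split: split_indicator)
        also have "\<dots> \<le> ennreal (f z + 2 * \<epsilon>)"
          using level[OF True] by (intro ennreal_leI) (auto simp: i_def A_def algebra_simps)
        also have "\<dots> = ennreal (f z) + ennreal (2 * \<epsilon>)"
          using \<epsilon> by (simp add: f_def ennreal_plus)
        finally show ?thesis .
      next
        case False
        then have "indicator (A j) z = (0::ennreal)" for j by (auto simp: A_def)
        then show ?thesis by simp
      qed
    qed
    also have "\<dots> = (\<integral>\<^sup>+z. ennreal (f z) \<partial>M) + ennreal (2 * \<epsilon>) * emeasure M UNIV"
      using sets_eq_imp_space_eq[OF M(1)] by (subst nn_integral_add) auto
    finally show ?thesis .
  qed
  define m where "m = measure M UNIV"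
  have m: "emeasure M UNIV = ennreal m"
    using fin by (simp add: m_def emeasure_eq_ennreal_measure less_top)
  have "ennreal (u b - u a) \<le> (\<integral>\<^sup>+z. ennreal (f z) \<partial>M)"
  proof (rule ennreal_le_epsilon)
    fix e :: real assume e: "0 < e"
    \<comment> \<open>The summand 1 keeps the denominator positive when the total mass is 0.\<close>
    define \<epsilon> where "\<epsilon> = e / (2 * (m + 1))"
    have m0: "0 \<le> m" by (simp add: m_def)
    have \<epsilon>: "0 < \<epsilon>" using e m0 by (simp add: \<epsilon>_def)
    have "2 * \<epsilon> * m \<le> e"
      using e m0 by (simp add: \<epsilon>_def field_simps)
    then have "ennreal (2 * \<epsilon> * m) \<le> ennreal e"
      by (rule ennreal_leI)
    then have "ennreal (2 * \<epsilon>) * emeasure M UNIV \<le> ennreal e"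
      unfolding m using \<epsilon> m0 by (subst ennreal_mult[symmetric]) auto
    then show "ennreal (u b - u a) \<le> (\<integral>\<^sup>+z. ennreal (f z) \<partial>M) + ennreal e"
      using approx[OF \<epsilon>] by (meson add_left_mono order.trans)
  qed
  then show ?thesis by (simp add: u_def f_def)
qed

section \<open>Frontiers of convex sets\<close>

lemma hausdorff1_mono: "A \<subseteq> B \<Longrightarrow> hausdorff1 A \<le> hausdorff1 B"
  unfolding hausdorff1_def by (intro SUP_mono' INF_superset_mono) auto

text \<open>A chord of the unit circle has length \<open>2 * \<bar>sin ((s - t) / 2)\<bar>\<close>,
  at most the arc.\<close>

lemma norm_cis_diff_le: "norm (cis s - cis t) \<le> \<bar>s - t\<bar>"
proof -
  have "(norm (cis s - cis t))\<^sup>2 = (cos s)\<^sup>2 + (sin s)\<^sup>2 + ((cos t)\<^sup>2 + (sin t)\<^sup>2) - 2 * (cos s * cos t + sin s * sin t)"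
    unfolding cmod_power2 by (simp add: power2_eq_square algebra_simps)
  also have "\<dots> = 2 - 2 * cos (2 * ((s - t) / 2))"
  proof -
    have "2 * ((s - t) / 2) = s - t" by simp
    then show ?thesis by (simp only: cos_diff sin_cos_squared_add2)
  qed
  also have "\<dots> = (2 * \<bar>sin ((s - t) / 2)\<bar>)\<^sup>2"
    unfolding cos_double_sin by (simp add: power_mult_distrib)
  also have "\<dots> \<le> (2 * \<bar>(s - t) / 2\<bar>)\<^sup>2"
    by (intro power_mono mult_left_mono abs_sin_x_le_abs_x) auto
  also have "2 * \<bar>(s - t) / 2\<bar> = \<bar>s - t\<bar>" by simp
  finally show ?thesis
    by (rule power2_le_imp_le) simp
qed

text \<open>Walking from \<zeta> along an outer normal until the sphere is met yields a point whose
  projection onto \<open>K\<close> is \<zeta>.\<close>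

lemma frontier_eq_closest_point:
  fixes K :: "complex set"
  assumes K: "convex K" "closed K" "interior K \<noteq> {}" and r: "K \<subseteq> ball z0 r" and \<zeta>: "\<zeta> \<in> frontier K"
  shows "\<exists>x\<in>sphere z0 r. closest_point K x = \<zeta>"
proof -
  obtain \<nu> where \<nu>: "norm \<nu> = 1" "\<And>z. z \<in> K \<Longrightarrow> Re ((z - \<zeta>) * cnj \<nu>) \<le> 0"
    using outer_normal_ex[OF K \<zeta>] by (auto simp: outer_normal_def)
  have \<zeta>K: "\<zeta> \<in> K" using \<zeta> K by (simp add: frontier_def)
  then have \<zeta>r: "norm (\<zeta> - z0) < r" using r by (auto simp: dist_norm norm_minus_commute)
  define f where "f s = norm (\<zeta> + of_real s * \<nu> - z0)" for s
  have "f 0 \<le> r" using \<zeta>r by (simp add: f_def)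
  \<comment> \<open>A displacement of length \<open>2 * r\<close> from a point within
    \<open>r\<close> of the centre ends at distance at least \<open>r\<close>, so the sphere is
    crossed on the way.\<close>
  moreover have "r \<le> f (2 * r)"
  proof -
    have "2 * r = norm (of_real (2 * r) * \<nu>)"
      using \<zeta>r \<nu> norm_ge_zero[of "\<zeta> - z0"] by (simp add: norm_mult del: norm_ge_zero)
    also have "of_real (2 * r) * \<nu> = (\<zeta> + of_real (2 * r) * \<nu> - z0) - (\<zeta> - z0)" by simp
    also have "norm \<dots> \<le> f (2 * r) + norm (\<zeta> - z0)"
      unfolding f_def by (rule norm_triangle_ineq4)
    finally show ?thesis using \<zeta>r by simp
  qed
  moreover have "0 \<le> 2 * r" using \<zeta>r norm_ge_zero[of "\<zeta> - z0"] by linarith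
  moreover have "continuous_on {0..2 * r} f"
    unfolding f_def by (intro continuous_intros)
  ultimately obtain s where s: "0 \<le> s" "f s = r"
    using IVT'[of f 0 r "2 * r"] by blast
  define x where "x = \<zeta> + of_real s * \<nu>"
  have "\<zeta> = closest_point K x"
  \<comment> \<open>For every \<open>z\<close> in \<open>K\<close>, the component of
    \<open>x - z\<close> along \<nu> is at least \<open>s\<close>, the distance from
    \<open>x\<close> to \<zeta>.\<close>
  proof (rule closest_point_unique[OF K(1,2) \<zeta>K], intro ballI)
    fix z assume z: "z \<in> K"
    have nn: "\<nu> * cnj \<nu> = 1"
      using \<nu>(1) by (simp add: complex_norm_square[symmetric])
    have "dist x \<zeta> = s"
      using s \<nu> by (simp add: x_def dist_norm norm_mult)
    also have "s = Re (of_real s * (\<nu> * cnj \<nu>))"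
      by (simp add: nn)
    also have "\<dots> = Re ((x - z) * cnj \<nu>) + Re ((z - \<zeta>) * cnj \<nu>)"
      unfolding plus_complex.sel(1)[symmetric] x_def by (simp only: ring_distribs ac_simps) (simp add: algebra_simps)
    also have "\<dots> \<le> Re ((x - z) * cnj \<nu>)"
      using \<nu>(2)[OF z] by simp
    also have "\<dots> \<le> norm ((x - z) * cnj \<nu>)"
      by (rule complex_Re_le_cmod)
    also have "\<dots> = dist x z"
      using \<nu> by (simp add: norm_mult dist_norm)
    finally show "dist x \<zeta> \<le> dist x z" .
  qed
  moreover have "x \<in> sphere z0 r"
    using s(2) by (simp add: f_def x_def dist_norm norm_minus_commute)
  ultimately show ?thesis by blast
qed

text \<open>The nearest-point projection does not increase distances and maps the enclosing circle
  onto a set containing the frontier.\<close>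

lemma hausdorff1_frontier_le:
  fixes K :: "complex set"
  assumes K: "convex K" "closed K" "interior K \<noteq> {}" and r: "K \<subseteq> ball z0 r"
  shows "hausdorff1 (frontier K) \<le> ennreal (2 * pi * r)"
proof -
  have ne: "K \<noteq> {}" using K(3) interior_subset by blast
  then have r0: "0 < r" using r by (metis ball_eq_empty not_le subset_empty)
  define g where "g t = closest_point K (z0 + of_real r * cis t)" for t
  have "frontier K \<subseteq> g ` {0..2 * pi}"
  proof
    fix \<zeta> assume "\<zeta> \<in> frontier K"
    then obtain x where "x \<in> sphere z0 r" and "closest_point K x = \<zeta>"
      using frontier_eq_closest_point[OF K r] by blast
    then have x: "norm (x - z0) = r" "closest_point K x = \<zeta>"
      by (auto simp: dist_norm norm_minus_commute)
    have "x - z0 = of_real r * cis (Arg2pi (x - z0))"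
      using Arg2pi_eq[of "x - z0"] x(1) by (simp add: cis_conv_exp mult.commute)
    then have "\<zeta> = g (Arg2pi (x - z0))"
      using x(2) by (simp add: g_def flip: \<open>x - z0 = _\<close>)
    moreover have "Arg2pi (x - z0) \<in> {0..2 * pi}"
      using Arg2pi[of "x - z0"] by auto
    ultimately show "\<zeta> \<in> g ` {0..2 * pi}" by blast
  qed
  then have "hausdorff1 (frontier K) \<le> hausdorff1 (g ` {0..2 * pi})"
    by (rule hausdorff1_mono)
  also have "\<dots> \<le> ennreal (r * (2 * pi))"
  proof (rule hausdorff1_lipschitz_path_le)
    fix s t :: real
    have "norm (g s - g t) \<le> norm (of_real r * (cis s - cis t))"
      using closest_point_lipschitz[OF K(1,2) ne, of "z0 + of_real r * cis s" "z0 + of_real r * cis t"]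
      by (simp add: g_def dist_norm right_diff_distrib)
    also have "\<dots> \<le> r * \<bar>s - t\<bar>"
      unfolding norm_mult using r0 norm_cis_diff_le[of s t] by (simp add: mult_left_mono)
    finally show "norm (g s - g t) \<le> r * \<bar>s - t\<bar>" .
  qed (use r0 in auto)
  finally show ?thesis by (simp add: mult_ac)
qed

text \<open>Nonempty interior gives affine dimension 2 and identifies the frontier with the relative
  frontier, which is connected when the affine dimension is not 1.\<close>

lemma connected_frontier_convex:
  fixes K :: "complex set"
  assumes "convex K" "bounded K" "interior K \<noteq> {}"
  shows "connected (frontier K)"
  using connected_sphere_gen[OF assms(1,2)] aff_dim_nonempty_interior[OF assms(3)]
    rel_frontier_nonempty_interior[OF assms(3)] by simp

section \<open>The integral inequality\<close>

text \<open>Bernoulli's inequality, the tangent at 1. It is Young's inequality for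
  \<open>x powr q\<close> and 1 with weights \<open>1 / q\<close> and
  \<open>1 - 1 / q\<close>.\<close>

lemma powr_tangent:
  fixes x q :: real
  assumes "0 \<le> x" "1 \<le> q"
  shows "1 + q * (x - 1) \<le> x powr q"
proof (cases "x = 0")
  case False
  then have "(x powr q) powr (1 / q) * 1 powr (1 - 1 / q) \<le> 1 / q * (x powr q) + (1 - 1 / q) * 1"
    using assms by (intro Youngs_inequality_0) auto
  moreover have "(x powr q) powr (1 / q) = x"
    using assms False by (simp add: powr_powr)
  ultimately have "q * x \<le> q * (1 / q * (x powr q) + (1 - 1 / q) * 1)"
    using assms by (intro mult_left_mono) auto
  also have "\<dots> = x powr q + q - 1"
    using assms by (simp add: algebra_simps)
  finally show ?thesis
    by (simp add: algebra_simps)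
qed (use assms in auto)

text \<open>Jensen's inequality for the power \<open>q\<close>, phrased with a witness
  \<open>m\<close> for the mean so that total mass 0 is included.\<close>

lemma (in finite_measure) mean_powr_le:
  fixes f :: "'a \<Rightarrow> real"
  assumes f: "integrable M f" "\<And>x. 0 \<le> f x" and q: "1 \<le> q" and fq: "integrable M (\<lambda>x. f x powr q)"
  shows "\<exists>m\<ge>0. integral\<^sup>L M f = m * measure M (space M) \<and> m powr q * measure M (space M) \<le> integral\<^sup>L M (\<lambda>x. f x powr q)"
proof (cases "integral\<^sup>L M f = 0")
  case True
  then show ?thesis
    by (intro exI[of _ 0]) (auto intro!: integral_nonneg)
next
  case False
  define L where "L = measure M (space M)"
  have "L \<noteq> 0"
  proof
    assume "L = 0"
    then have "emeasure M (space M) = 0"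
      by (simp add: L_def emeasure_eq_measure)
    then have "AE x in M. f x = 0"
      by (intro AE_I[where N = "space M"]) auto
    with False show False
      using integral_eq_zero_AE by blast
  qed
  then have L: "0 < L" by (simp add: L_def zero_less_measure_iff)
  define m where "m = integral\<^sup>L M f / L"
  have m: "0 < m" "integral\<^sup>L M f = m * L"
    using False L f(2) by (auto simp: m_def order_less_le intro!: divide_nonneg_pos integral_nonneg)
  \<comment> \<open>The tangent inequality is integrated; its linear part contributes 0 because
    \<open>m\<close> is the mean of \<open>f\<close>.\<close>
  have "(\<integral>x. 1 + q * (f x / m - 1) \<partial>M) \<le> (\<integral>x. f x powr q / m powr q \<partial>M)"
  proof (rule integral_mono)
    show "1 + q * (f x / m - 1) \<le> f x powr q / m powr q" for x
      using powr_tangent[of "f x / m" q] m(1) f(2)[of x] q by (simp add: powr_divide)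
  qed (use f fq in auto)
  also have "(\<integral>x. 1 + q * (f x / m - 1) \<partial>M) = L"
    using f(1) m L by (simp add: L_def[symmetric])
  finally have "L \<le> integral\<^sup>L M (\<lambda>x. f x powr q) / m powr q"
    using fq by simp
  then show ?thesis
    using m by (intro exI[of _ m]) (auto simp: L_def field_simps)
qed

lemma integrable_norm_poly_powr:
  fixes p :: "complex poly"
  assumes M: "finite_measure M" "sets M = sets borel" and S: "compact S" "AE z in M. z \<in> S" and q: "0 \<le> q"
  shows "integrable M (\<lambda>z. norm (poly p z) powr q)"
proof -
  have "bounded (poly p ` S)"
    using S(1) by (intro compact_imp_bounded compact_continuous_image continuous_intros)
  then obtain B where "\<And>z. z \<in> S \<Longrightarrow> norm (poly p z) \<le> B"
    unfolding bounded_iff by blast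
  then have "AE z in M. norm (norm (poly p z) powr q) \<le> B powr q"
    using S(2) q by (auto elim!: eventually_mono intro!: powr_mono2)
  moreover have "poly p \<in> borel_measurable borel"
    by (intro borel_measurable_continuous_onI continuous_intros)
  then have "(\<lambda>z. norm (poly p z) powr q) \<in> borel_measurable M"
    unfolding measurable_cong_sets[OF M(2) refl] by measurable
  ultimately show ?thesis
    by (rule finite_measure.integrable_const_bound[OF M(1)])
qed

theorem theorem3:
  fixes K :: "complex set" and q :: real and n :: nat and p :: "complex poly"
  assumes "convex_domain K"
    and "depth K > 0"
    and "1 \<le> q"
    and "degree p = n"
    and "\<forall>z. poly p z = 0 \<longrightarrow> z \<in> K"
  shows "Lq_boundary_norm K q (poly (pderiv p))
           \<ge> depth K ^ 4 / (3000 * diameter K ^ 5) * real n * Lq_boundary_norm K q (poly p)"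
proof (cases "n = 0")
  case True
  then show ?thesis by (simp add: Lq_boundary_norm_def)
next
  case False

  \<comment> \<open>Geometric constants of the domain\<close>
  define d where "d = diameter K"
  define D where "D = depth K"
  define S where "S = frontier K"
  define M where "M = arc_measure S"
  have cK: "compact K" "convex K" "closed K" "bounded K" "interior K \<noteq> {}"
    using assms(1) by (auto simp: convex_domain_def compact_imp_closed compact_imp_bounded)
  have S: "compact S" "connected S" "S \<subseteq> K" "S \<in> sets borel"
    using cK connected_frontier_convex[OF cK(2,4,5)] frontier_subset_closed[OF cK(3)]
    by (auto simp: S_def compact_frontier borel_closed)
  have ne: "K \<noteq> {}" using cK(5) interior_subset by blast
  have "S \<noteq> {}"
    unfolding S_def using ne cK(4) not_bounded_UNIV by (metis frontier_not_empty)
  then obtain \<zeta>0 where \<zeta>0: "\<zeta>0 \<in> S" by blast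
  have D0: "0 < D" using assms(2) by (simp add: D_def)
  have d0: "0 < d"
    using depth_chord_ex[OF assms(1), of \<zeta>0 0] \<zeta>0 assms(2) by (auto simp: S_def d_def)
  \<comment> \<open>If \<open>d < D\<close>, taking \<open>c = d\<close> would produce a chord
    longer than the diameter.\<close>
  have Dd: "D \<le> d"
    using depth_chord_ex[OF assms(1), of \<zeta>0 d] \<zeta>0 by (force simp: S_def d_def D_def not_le)
  have H_S: "hausdorff1 S \<le> ennreal (9 * d)"
  proof -
    obtain z0 where "z0 \<in> K" using ne by blast
    \<comment> \<open>The radius exceeds \<open>d\<close> because the ball is open; 9/8 is chosen so
      that \<open>pi < 4\<close> bounds the circumference by \<open>9 * d\<close>.\<close>
    then have "K \<subseteq> ball z0 (9 / 8 * d)"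
      using diameter_bounded_bound[OF cK(4), of z0] d0 by (fastforce simp: d_def)
    then have "hausdorff1 S \<le> ennreal (2 * pi * (9 / 8 * d))"
      unfolding S_def by (rule hausdorff1_frontier_le[OF cK(2,3,5)])
    also have "2 * pi * (9 / 8 * d) \<le> 2 * 4 * (9 / 8 * d)"
      using pi_less_4 d0 by (intro mult_right_mono) auto
    finally show ?thesis by (simp add: ennreal_leI)
  qed
  from arc_measure_cases[of S] show ?thesis
  proof
    assume "\<forall>A. emeasure (arc_measure S) A = 0"
    then have "AE z in M. P z" for P
      by (intro AE_I[where N = "space M"]) (auto simp: M_def)
    then have "integral\<^sup>L M f = 0" for f :: "complex \<Rightarrow> real"
      by (intro integral_eq_zero_AE)
    then show ?thesis by (simp add: Lq_boundary_norm_def M_def S_def)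
  next
    assume "\<forall>A\<in>sets borel. emeasure (arc_measure S) A = hausdorff1 (A \<inter> S)"
    then have eM: "emeasure M A = hausdorff1 (A \<inter> S)" if "A \<in> sets borel" for A
      using that by (simp add: M_def)
    have sM: "sets M = sets borel" and spM: "space M = UNIV" by (simp_all add: M_def)
    have fin: "emeasure M UNIV \<le> ennreal (9 * d)"
      using eM[of UNIV] H_S by simp
    interpret finite_measure M
      using fin by (intro finite_measureI) (auto simp: spM top_unique)
    define L where "L = measure M (space M)"
    have L: "L \<le> 9 * d"
      using fin d0 by (simp add: L_def spM emeasure_eq_measure)
    have AE_S: "AE z in M. z \<in> S"
    proof (rule AE_I)
      show "emeasure M (- S) = 0"
        using eM[of "- S"] eM[of "{}"] S(4) by simp
    qed (use S(4) in \<open>auto simp: sM spM\<close>)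
    note int = integrable_norm_poly_powr[OF finite_measure_axioms sM S(1) AE_S]
    define f where "f z = norm (poly (pderiv p) z)" for z
    have int_f: "integrable M f" and int_fq: "integrable M (\<lambda>z. f z powr q)"
      using int[of 1 "pderiv p"] int[of q "pderiv p"] assms(3) by (simp_all add: f_def[abs_def])
    have f_nonneg: "0 \<le> f z" for z
      by (simp add: f_def)
    obtain m where m: "0 \<le> m" "integral\<^sup>L M f = m * L" "m powr q * L \<le> (\<integral>z. f z powr q \<partial>M)"
      using mean_powr_le[OF int_f f_nonneg assms(3) int_fq] unfolding L_def by blast
    have growth: "norm (poly p b) - norm (poly p a) \<le> m * L" if "a \<in> S" "b \<in> S" for a b
    proof -
      have "ennreal (norm (poly p b) - norm (poly p a)) \<le> (\<integral>\<^sup>+z. ennreal (f z) \<partial>M)"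
        unfolding f_def using fin
        by (intro norm_poly_diff_le_nn_integral[OF cK(1,2) S(1-3) that sM eM])
           (auto simp: le_less_trans)
      also have "\<dots> = ennreal (m * L)"
        using int_f by (subst nn_integral_eq_integral) (auto simp: f_def m(2)[symmetric])
      finally show ?thesis
        using m(1) by (simp add: L_def)
    qed
    \<comment> \<open>The factor 3/4 keeps the required chord length strictly below the depth;
      \<alpha> equals \<open>D\<^sup>2 / (800 * d ^ 3)\<close>.\<close>
    define \<alpha> where "\<alpha> = (3 / 4 * D)\<^sup>2 / (450 * d ^ 3)"
    have \<alpha>0: "0 < \<alpha>" using D0 d0 by (simp add: \<alpha>_def)
    have dich: "\<alpha> * real n * norm (poly p \<zeta>) \<le> f \<zeta> \<or> \<alpha> * real n * norm (poly p \<zeta>) \<le> m"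
      if \<zeta>: "\<zeta> \<in> S" for \<zeta>
    proof -
      obtain \<nu> h where \<nu>: "outer_normal K \<zeta> \<nu>" and h: "3 / 4 * D < h" "h \<le> d"
          and seg: "closed_segment \<zeta> (\<zeta> - complex_of_real h * \<nu>) \<subseteq> K"
        using depth_chord_ex[OF assms(1), of \<zeta> "3 / 4 * D"] \<zeta> D0 by (auto simp: S_def d_def D_def)
      have h0: "0 < h" using h D0 by simp
      have zeros: "Re ((z - \<zeta>) * cnj \<nu>) \<le> 0 \<and> norm (z - \<zeta>) \<le> d" if "poly p z = 0" for z
      proof -
        have "z \<in> K" using assms(5) that by blast
        then show ?thesis
          using \<nu> diameter_bounded_bound[OF cK(4), of z \<zeta>] \<zeta> S(3)
          unfolding outer_normal_def d_def dist_norm by blast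
      qed
      define a where "a = h\<^sup>2 / (450 * d ^ 3)"
      have "\<alpha> \<le> a"
        unfolding \<alpha>_def a_def using h D0 d0 by (intro divide_right_mono power_mono) auto
      then have \<alpha>a: "\<alpha> * real n * norm (poly p \<zeta>) \<le> a * real n * norm (poly p \<zeta>)"
        by (intro mult_right_mono) auto
      have "norm \<nu> = 1" using \<nu> by (simp add: outer_normal_def)
      with zeros have "h\<^sup>2 / (450 * d ^ 3) * real (degree p) * norm (poly p \<zeta>) \<le> norm (poly (pderiv p) \<zeta>) \<or>
          (\<exists>t\<in>{1/2..1}. exp (9 * (h / d)\<^sup>2 * real (degree p) / 450) * norm (poly p \<zeta>)
              \<le> norm (poly p (\<zeta> - of_real (t * h) * \<nu>)))"
        by (rule pderiv_or_growth_along_normal) (use h0 h in auto)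
      then show ?thesis
        unfolding assms(4)
      proof
        assume "h\<^sup>2 / (450 * d ^ 3) * real n * norm (poly p \<zeta>) \<le> norm (poly (pderiv p) \<zeta>)"
        then show ?thesis using \<alpha>a by (simp add: a_def f_def)
      next
        assume "\<exists>t\<in>{1/2..1}. exp (9 * (h / d)\<^sup>2 * real n / 450) * norm (poly p \<zeta>)
              \<le> norm (poly p (\<zeta> - of_real (t * h) * \<nu>))"
        then obtain t where t: "t \<in> {1/2..1}"
            "exp (9 * (h / d)\<^sup>2 * real n / 450) * norm (poly p \<zeta>) \<le> norm (poly p (\<zeta> - of_real (t * h) * \<nu>))"
          by blast
        define w where "w = \<zeta> - of_real (t * h) * \<nu>"
        have "w = (1 - t) *\<^sub>R \<zeta> + t *\<^sub>R (\<zeta> - of_real h * \<nu>)"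
          by (simp add: w_def scaleR_conv_of_real algebra_simps)
        then have "w \<in> K"
          using seg t(1) by (intro subsetD[OF seg]) (auto simp: in_segment intro!: exI[of _ t])
        have "continuous_on S (\<lambda>z. norm (poly p z))"
          by (intro continuous_intros)
        then obtain b where b: "b \<in> S" "\<And>z. z \<in> S \<Longrightarrow> norm (poly p z) \<le> norm (poly p b)"
          using continuous_attains_sup[OF S(1) \<open>S \<noteq> {}\<close>] by blast
        have "norm (poly p w) \<le> norm (poly p b)"
        proof (rule maximum_modulus_frontier[OF _ _ cK(4) _ \<open>w \<in> K\<close>])
          show "poly p holomorphic_on interior K" "continuous_on (closure K) (poly p)"
            by (intro holomorphic_intros continuous_intros)+
        qed (use b(2) in \<open>simp add: S_def\<close>)
        \<comment> \<open>In this form \<open>1 + x \<le> exp x\<close> produces a factor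
          \<open>9 * d\<close> that cancels against \<open>L \<le> 9 * d\<close>.\<close>
        have rate: "9 * d * a * real n = 9 * (h / d)\<^sup>2 * real n / 450"
          using d0 by (simp add: a_def power2_eq_square power3_eq_cube field_simps)
        have "(1 + 9 * d * a * real n) * norm (poly p \<zeta>) \<le> exp (9 * d * a * real n) * norm (poly p \<zeta>)"
          by (intro mult_right_mono exp_ge_add_one_self) auto
        also have "\<dots> \<le> norm (poly p b)"
          using t(2) \<open>norm (poly p w) \<le> norm (poly p b)\<close> unfolding rate by (simp add: w_def)
        finally have "(9 * d) * (a * real n * norm (poly p \<zeta>)) \<le> m * L"
          using growth[OF \<zeta> b(1)] by (simp add: algebra_simps)
        also have "\<dots> \<le> (9 * d) * m"
          using mult_left_mono[OF L m(1)] by (simp only: mult.commute)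
        finally have "a * real n * norm (poly p \<zeta>) \<le> m"
          using d0 by simp
        then show ?thesis using \<alpha>a by simp
      qed
    qed

    \<comment> \<open>Integration of the q-th powers\<close>
    define P where "P = (\<integral>z. norm (poly p z) powr q \<partial>M)"
    define I where "I = (\<integral>z. f z powr q \<partial>M)"
    have I0: "0 \<le> I" and P0: "0 \<le> P" by (auto simp: I_def P_def intro!: integral_nonneg)
    have "(\<alpha> * real n) powr q * P = (\<integral>z. (\<alpha> * real n) powr q * norm (poly p z) powr q \<partial>M)"
      by (simp add: P_def)
    also have "\<dots> \<le> (\<integral>z. f z powr q + m powr q \<partial>M)"
    proof (rule integral_mono_AE)
      show "integrable M (\<lambda>z. (\<alpha> * real n) powr q * norm (poly p z) powr q)"
        using int[of q p] assms(3) by simp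
      show "integrable M (\<lambda>z. f z powr q + m powr q)"
        using int_fq by simp
      \<comment> \<open>The sum of the two q-th powers covers both alternatives at once, so the
        boundary need not be split.\<close>
      have "(\<alpha> * real n) powr q * norm (poly p z) powr q \<le> f z powr q + m powr q" if "z \<in> S" for z
      proof -
        have "(\<alpha> * real n) powr q * norm (poly p z) powr q = (\<alpha> * real n * norm (poly p z)) powr q"
          using \<alpha>0 by (simp add: powr_mult)
        moreover have "0 \<le> \<alpha> * real n * norm (poly p z)"
          using \<alpha>0 by simp
        then have "(\<alpha> * real n * norm (poly p z)) powr q \<le> f z powr q \<or>
            (\<alpha> * real n * norm (poly p z)) powr q \<le> m powr q"
          using dich[OF that] assms(3) by (auto intro!: powr_mono2)
        moreover have "0 \<le> f z powr q" "0 \<le> m powr q" by simp_all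
        ultimately show ?thesis by linarith
      qed
      then show "AE z in M. (\<alpha> * real n) powr q * norm (poly p z) powr q \<le> f z powr q + m powr q"
        using AE_S by (auto elim!: eventually_mono)
    qed
    also have "\<dots> = I + m powr q * L"
      using int_fq by (simp add: I_def L_def)
    also have "\<dots> \<le> 2 * I"
      using m(3) by (simp add: I_def)
    finally have "((\<alpha> * real n) powr q * P) powr (1 / q) \<le> (2 * I) powr (1 / q)"
      using P0 assms(3) by (intro powr_mono2) auto
    also have "((\<alpha> * real n) powr q * P) powr (1 / q) = \<alpha> * real n * P powr (1 / q)"
      using \<alpha>0 P0 False assms(3) by (simp add: powr_mult powr_powr)
    also have "(2 * I) powr (1 / q) = 2 powr (1 / q) * I powr (1 / q)"
      using I0 by (simp add: powr_mult)
    \<comment> \<open>\<open>q \<ge> 1\<close> makes the constant uniform in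
      \<open>q\<close>.\<close>
    also have "\<dots> \<le> 2 powr 1 * I powr (1 / q)"
      using assms(3) by (intro mult_right_mono powr_mono) auto
    finally have main: "\<alpha> / 2 * real n * P powr (1 / q) \<le> I powr (1 / q)"
      by simp
    \<comment> \<open>Since \<open>\<alpha> / 2\<close> is
      \<open>D\<^sup>2 / (1600 * d ^ 3)\<close>, the bound obtained is stronger;
      \<open>D \<le> d\<close> weakens it to the stated form.\<close>
    have "D ^ 4 / (3000 * d ^ 5) = (D\<^sup>2 / (3000 * d ^ 3)) * (D / d)\<^sup>2"
      using d0 by (simp add: field_simps eval_nat_numeral)
    also have "\<dots> \<le> (D\<^sup>2 / (3000 * d ^ 3)) * 1"
      using D0 d0 Dd by (intro mult_left_mono power_le_one) auto
    also have "\<dots> \<le> \<alpha> / 2"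
      using d0 by (simp add: \<alpha>_def field_simps power2_eq_square)
    finally have "D ^ 4 / (3000 * d ^ 5) * real n * P powr (1 / q) \<le> \<alpha> / 2 * real n * P powr (1 / q)"
      by (intro mult_right_mono) auto
    also note main
    finally show ?thesis
      by (simp add: Lq_boundary_norm_def P_def I_def f_def M_def S_def D_def d_def)
  qed
qed

end
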